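(* Each of the modal systems $\mathsf{K}_n\mathbf{D}$, $\mathsf{D}_n\mathbf{D}$ and $\mathsf{T}_n\mathbf{D}$ has the uniform interpolation property.
   Context: Fix a finite nonempty set $\mathcal{A}$ of $n$ agents and a countable set $\mathcal{P}$ of atoms. For a set $X$, $\mathcal{P}^+(X)$ denotes the set of nonempty subsets of $X$. The language $\mathcal{L}_{\mathbf{D}}$ is given by $\phi ::= p \mid \neg\phi \mid \phi\wedge\phi \mid \phi\vee\phi \mid \mathbf{K}_i\phi \mid \mathbf{D}_{\mathcal{B}}\phi$ with $p\in\mathcal{P}$, $i\in\mathcal{A}$, $\mathcal{B}\in\mathcal{P}^+(\mathcal{A})$. A model is $M=(S,R,V)$ with $S$ a nonempty set, $R_i\subseteq S\times S$ for each $i\in\mathcal{A}$, and $V:S\to 2^{\mathcal{P}}$; write $R_{\mathcal{B}}=\bigcap_{i\in\mathcal{B}}R_i$ and $R_{\mathcal{B}}(s)=\{t\mid (s,t)\in R_{\mathcal{B}}\}$. Truth is standard: $M,s\models p$ iff $p\in V(s)$, Boolean clauses as usual, $M,s\models \mathbf{K}_i\phi$ iff $M,t\models\phi$ for all $t\in R_i(s)$, and $M,s\models\mathbf{D}_{\mathcal{B}}\phi$ iff $M,t\models\phi$ for all $t\in R_{\mathcal{B}}(s)$. A $\mathsf{K}_n\mathbf{D}$-model is any model; a $\mathsf{D}_n\mathbf{D}$-model is one in which every $R_i$ is serial; a $\mathsf{T}_n\mathbf{D}$-model is one in which every $R_i$ is reflexive. For such a system $\mathsf{L}$: $\phi$ is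 $\mathsf{L}$-satisfiable if $M,s\models\phi$ for some $\mathsf{L}$-model $M$ and world $s$; $\phi\models_{\mathsf L}\psi$ means every pointed $\mathsf L$-model of $\phi$ satisfies $\psi$. A formula is over $P\subseteq\mathcal P$ if every atom occurring in it lies in $P$. $\mathsf{L}$ has the uniform interpolation property if for every finite $P\subseteq\mathcal{P}$, every $\mathsf L$-satisfiable formula $\phi$ over $P$ and every $p\in P$, there is an $\mathsf L$-satisfiable formula $\psi$ over $P\setminus\{p\}$ such that for every formula $\chi$ in which $p$ does not occur, $\phi\models_{\mathsf L}\chi$ iff $\psi\models_{\mathsf L}\chi$.
   Formalization: The constant ⊤ is added to the language, since otherwise no formula is over the empty set and the property fails for P={p}, φ=p; models have worlds in an arbitrary fixed infinite set type, which by Löwenheim–Skolem does not change satisfiability or entailment. *)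

theory Defs
  imports "HOL-Library.Infinite_Typeclass" "HOL-Library.Countable_Set"
begin

typedef 'a neset = "{B :: 'a set. B \<noteq> {}}"
  morphisms set_of_neset Abs_neset
  by blast

text \<open>
  The constant \<open>Top\<close> is primitive: otherwise every formula would contain an atom, there would
  be no formula at all over the empty set of atoms, and uniform interpolation would fail trivially
  for \<open>P = {p}\<close>. In all other cases
  \<open>Top\<close> is eliminable; see \<open>uniform_interpolation_top_free\<close> below.
\<close>

datatype ('a, 'p) fm =
    Atom 'p
  | Top
  | Neg "('a, 'p) fm"
  | Conj "('a, 'p) fm" "('a, 'p) fm"
  | Disj "('a, 'p) fm" "('a, 'p) fm"
  | Know 'a "('a, 'p) fm"
  | Dist "'a neset" "('a, 'p) fm"

primrec atoms :: "('a, 'p) fm \<Rightarrow> 'p set" where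
  "atoms (Atom p) = {p}"
| "atoms Top = {}"
| "atoms (Neg \<phi>) = atoms \<phi>"
| "atoms (Conj \<phi> \<psi>) = atoms \<phi> \<union> atoms \<psi>"
| "atoms (Disj \<phi> \<psi>) = atoms \<phi> \<union> atoms \<psi>"
| "atoms (Know i \<phi>) = atoms \<phi>"
| "atoms (Dist B \<phi>) = atoms \<phi>"

record ('a, 'p, 'w) model =
  worlds :: "'w set"
  acc :: "'a \<Rightarrow> ('w \<times> 'w) set"
  val :: "'w \<Rightarrow> 'p set"

definition group_acc :: "('a, 'p, 'w) model \<Rightarrow> 'a set \<Rightarrow> ('w \<times> 'w) set" where
  "group_acc M B = (\<Inter>i\<in>B. acc M i)"

primrec sat :: "('a, 'p, 'w) model \<Rightarrow> 'w \<Rightarrow> ('a, 'p) fm \<Rightarrow> bool" where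
  "sat M s (Atom p) \<longleftrightarrow> p \<in> val M s"
| "sat M s Top \<longleftrightarrow> True"
| "sat M s (Neg \<phi>) \<longleftrightarrow> \<not> sat M s \<phi>"
| "sat M s (Conj \<phi> \<psi>) \<longleftrightarrow> sat M s \<phi> \<and> sat M s \<psi>"
| "sat M s (Disj \<phi> \<psi>) \<longleftrightarrow> sat M s \<phi> \<or> sat M s \<psi>"
| "sat M s (Know i \<phi>) \<longleftrightarrow> (\<forall>t. (s, t) \<in> acc M i \<longrightarrow> sat M t \<phi>)"
| "sat M s (Dist B \<phi>) \<longleftrightarrow> (\<forall>t. (s, t) \<in> group_acc M (set_of_neset B) \<longrightarrow> sat M t \<phi>)"

text \<open>A system is identified with its class of models, whose worlds are drawn from a type \<open>'w\<close>.\<close>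

definition KnD :: "('a, 'p, 'w) model set" where
  "KnD = {M. worlds M \<noteq> {} \<and> (\<forall>i. acc M i \<subseteq> worlds M \<times> worlds M)}"

definition DnD :: "('a, 'p, 'w) model set" where
  "DnD = {M \<in> KnD. \<forall>i. \<forall>s\<in>worlds M. \<exists>t\<in>worlds M. (s, t) \<in> acc M i}"

definition TnD :: "('a, 'p, 'w) model set" where
  "TnD = {M \<in> KnD. \<forall>i. \<forall>s\<in>worlds M. (s, s) \<in> acc M i}"

definition satisfiable :: "('a, 'p, 'w) model set \<Rightarrow> ('a, 'p) fm \<Rightarrow> bool" where
  "satisfiable L \<phi> \<longleftrightarrow> (\<exists>M\<in>L. \<exists>s\<in>worlds M. sat M s \<phi>)"

definition entails :: "('a, 'p, 'w) model set \<Rightarrow> ('a, 'p) fm \<Rightarrow> ('a, 'p) fm \<Rightarrow> bool" where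
  "entails L \<phi> \<psi> \<longleftrightarrow> (\<forall>M\<in>L. \<forall>s\<in>worlds M. sat M s \<phi> \<longrightarrow> sat M s \<psi>)"

definition uniform_interpolation :: "('a, 'p, 'w) model set \<Rightarrow> bool" where
  "uniform_interpolation L \<longleftrightarrow>
    (\<forall>P \<phi> p. finite P \<longrightarrow> atoms \<phi> \<subseteq> P \<longrightarrow> satisfiable L \<phi> \<longrightarrow> p \<in> P \<longrightarrow>
      (\<exists>\<psi>. atoms \<psi> \<subseteq> P - {p} \<and> satisfiable L \<psi> \<and>
        (\<forall>\<chi>. p \<notin> atoms \<chi> \<longrightarrow> (entails L \<phi> \<chi> \<longleftrightarrow> entails L \<psi> \<chi>))))"

primrec top_free :: "('a, 'p) fm \<Rightarrow> bool" where
  "top_free (Atom p) \<longleftrightarrow> True"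
| "top_free Top \<longleftrightarrow> False"
| "top_free (Neg \<phi>) \<longleftrightarrow> top_free \<phi>"
| "top_free (Conj \<phi> \<psi>) \<longleftrightarrow> top_free \<phi> \<and> top_free \<psi>"
| "top_free (Disj \<phi> \<psi>) \<longleftrightarrow> top_free \<phi> \<and> top_free \<psi>"
| "top_free (Know i \<phi>) \<longleftrightarrow> top_free \<phi>"
| "top_free (Dist B \<phi>) \<longleftrightarrow> top_free \<phi>"

primrec elim_top :: "'p \<Rightarrow> ('a, 'p) fm \<Rightarrow> ('a, 'p) fm" where
  "elim_top q (Atom p) = Atom p"
| "elim_top q Top = Disj (Atom q) (Neg (Atom q))"
| "elim_top q (Neg \<phi>) = Neg (elim_top q \<phi>)"
| "elim_top q (Conj \<phi> \<psi>) = Conj (elim_top q \<phi>) (elim_top q \<psi>)"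
| "elim_top q (Disj \<phi> \<psi>) = Disj (elim_top q \<phi>) (elim_top q \<psi>)"
| "elim_top q (Know i \<phi>) = Know i (elim_top q \<phi>)"
| "elim_top q (Dist B \<phi>) = Dist B (elim_top q \<phi>)"

lemma sat_elim_top: "sat M s (elim_top q \<phi>) \<longleftrightarrow> sat M s \<phi>"
  by (induction \<phi> arbitrary: s) simp_all

lemma top_free_elim_top: "top_free (elim_top q \<phi>)"
  by (induction \<phi>) simp_all

lemma atoms_elim_top: "atoms (elim_top q \<phi>) \<subseteq> insert q (atoms \<phi>)"
  by (induction \<phi>) auto

lemma uniform_interpolation_top_free:
  assumes UI: "uniform_interpolation L" and P: "finite P" "p \<in> P" "P \<noteq> {p}"
    and \<phi>: "atoms \<phi> \<subseteq> P" "satisfiable L \<phi>"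
  shows "\<exists>\<psi>. top_free \<psi> \<and> atoms \<psi> \<subseteq> P - {p} \<and> satisfiable L \<psi> \<and>
    (\<forall>\<chi>. top_free \<chi> \<longrightarrow> p \<notin> atoms \<chi> \<longrightarrow> (entails L \<phi> \<chi> \<longleftrightarrow> entails L \<psi> \<chi>))"
proof -
  from P obtain q where q: "q \<in> P - {p}" by blast
  from UI[unfolded uniform_interpolation_def, rule_format, OF P(1) \<phi> P(2)]
  obtain \<psi> where \<psi>: "atoms \<psi> \<subseteq> P - {p}" "satisfiable L \<psi>"
    "\<forall>\<chi>. p \<notin> atoms \<chi> \<longrightarrow> (entails L \<phi> \<chi> \<longleftrightarrow> entails L \<psi> \<chi>)"
    by auto
  have "atoms (elim_top q \<psi>) \<subseteq> P - {p}"
    using \<psi>(1) q atoms_elim_top[of q \<psi>] by blast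
  moreover have "satisfiable L (elim_top q \<psi>)"
    using \<psi>(2) by (simp add: satisfiable_def sat_elim_top)
  moreover have "entails L (elim_top q \<psi>) \<chi> \<longleftrightarrow> entails L \<psi> \<chi>" for \<chi>
    by (simp add: entails_def sat_elim_top)
  ultimately show ?thesis
    using \<psi>(3) top_free_elim_top[of q \<psi>] by (intro exI[of _ "elim_top q \<psi>"]) simp
qed

text \<open>
  Satisfiability and entailment do not depend on the type of worlds, as long as that type is
  infinite: by a downward Loewenheim-Skolem argument, a formula satisfiable in a model over any
  type is satisfiable in a model of the same system over any given infinite type.
\<close>

primrec subfms :: "('a, 'p) fm \<Rightarrow> ('a, 'p) fm set" where
  "subfms (Atom p) = {Atom p}"
| "subfms Top = {Top}"
| "subfms (Neg \<phi>) = insert (Neg \<phi>) (subfms \<phi>)"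
| "subfms (Conj \<phi> \<psi>) = insert (Conj \<phi> \<psi>) (subfms \<phi> \<union> subfms \<psi>)"
| "subfms (Disj \<phi> \<psi>) = insert (Disj \<phi> \<psi>) (subfms \<phi> \<union> subfms \<psi>)"
| "subfms (Know i \<phi>) = insert (Know i \<phi>) (subfms \<phi>)"
| "subfms (Dist B \<phi>) = insert (Dist B \<phi>) (subfms \<phi>)"

lemma finite_subfms: "finite (subfms \<phi>)"
  by (induction \<phi>) simp_all

lemma subfms_refl: "\<phi> \<in> subfms \<phi>"
  by (cases \<phi>) simp_all

lemma countable_submodel:
  fixes M :: "('a::finite, 'p, 'v) model" and Qs :: "('v \<Rightarrow> bool) set"
  assumes M: "M \<in> KnD" and s: "s \<in> worlds M" and fin: "finite Qs"
  obtains W where "s \<in> W" "W \<subseteq> worlds M" "countable W"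
    "\<And>x t B Q. x \<in> W \<Longrightarrow> B \<noteq> {} \<Longrightarrow> Q \<in> Qs \<Longrightarrow> (x, t) \<in> group_acc M B \<Longrightarrow> Q t \<Longrightarrow>
       \<exists>t'\<in>W. (x, t') \<in> group_acc M B \<and> Q t'"
proof -
  define ok where "ok x B Q t \<longleftrightarrow> (x, t) \<in> group_acc M B \<and> Q t" for x B and Q :: "'v \<Rightarrow> bool" and t
  define g where "g x B Q = (if \<exists>t. ok x B Q t then SOME t. ok x B Q t else s)" for x B Q
  define step where "step X = X \<union> (\<Union>x\<in>X. (\<lambda>(B, Q). g x B Q) ` ((UNIV - {{}}) \<times> Qs))" for X
  define W where "W = (\<Union>n. (step ^^ n) {s})"
  have g: "ok x B Q (g x B Q)" if "ok x B Q t" for x B Q t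
    using that unfolding g_def by (auto intro: someI)
  have ok_w: "t \<in> worlds M" if "ok x B Q t" "B \<noteq> {}" for x B Q t
    using that M unfolding ok_def group_acc_def KnD_def by blast
  have gw: "g x B Q \<in> worlds M" if "B \<noteq> {}" for x B Q
  proof (cases "\<exists>t. ok x B Q t")
    case True
    then show ?thesis using g ok_w that by blast
  next
    case False
    then show ?thesis using s by (simp add: g_def)
  qed
  have sub: "(step ^^ n) {s} \<subseteq> worlds M" for n
  proof (induction n)
    case 0
    then show ?case using s by simp
  next
    case (Suc n)
    have "step X \<subseteq> worlds M" if "X \<subseteq> worlds M" for X
    proof
      fix y
      assume "y \<in> step X"
      then consider "y \<in> X" | x B Q where "B \<noteq> {}" "y = g x B Q"
        unfolding step_def by auto
      then show "y \<in> worlds M" using that gw by cases auto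
    qed
    with Suc show ?case by simp
  qed
  have cnt: "countable ((step ^^ n) {s})" for n
  proof (induction n)
    case 0
    then show ?case by simp
  next
    case (Suc n)
    have "countable ((UNIV - {{}} :: 'a set set) \<times> Qs)"
      using fin by (intro countable_finite finite_cartesian_product) simp_all
    with Suc show ?case
      by (auto simp: step_def intro!: countable_UN countable_image)
  qed
  show thesis
  proof (rule that[of W])
    show "s \<in> W" unfolding W_def by (rule UN_I[of 0]) simp_all
    show "W \<subseteq> worlds M" using sub by (auto simp: W_def)
    show "countable W" using cnt by (simp add: W_def)
    fix x t B Q
    assume x: "x \<in> W" and B: "B \<noteq> {}" "Q \<in> Qs" and t: "(x, t) \<in> group_acc M B" "Q t"
    then obtain n where n: "x \<in> (step ^^ n) {s}" by (auto simp: W_def)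
    have "g x B Q \<in> step ((step ^^ n) {s})"
      using n B unfolding step_def by blast
    then have "g x B Q \<in> (step ^^ Suc n) {s}" by simp
    then have "g x B Q \<in> W" unfolding W_def by blast
    moreover have "ok x B Q (g x B Q)" using g t unfolding ok_def by blast
    ultimately show "\<exists>t'\<in>W. (x, t') \<in> group_acc M B \<and> Q t'"
      unfolding ok_def by blast
  qed
qed

lemma model_transfer:
  fixes M :: "('a::finite, 'p, 'v) model"
  assumes M: "M \<in> KnD" and s: "s \<in> worlds M" and sat: "sat M s \<phi>"
  obtains N :: "('a, 'p, 'w::infinite) model" and t
  where "N \<in> KnD" "t \<in> worlds N" "sat N t \<phi>" "M \<in> DnD \<longrightarrow> N \<in> DnD" "M \<in> TnD \<longrightarrow> N \<in> TnD"
proof -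
  define Qs where "Qs = insert (\<lambda>_. True) ((\<lambda>\<chi> t. \<not> sat M t \<chi>) ` subfms \<phi>)"
  have "finite Qs" by (simp add: Qs_def finite_subfms)
  from countable_submodel[OF M s this] obtain W where
    sW: "s \<in> W" and W: "W \<subseteq> worlds M" and cW: "countable W" and
    wit: "\<And>x t B Q. x \<in> W \<Longrightarrow> B \<noteq> {} \<Longrightarrow> Q \<in> Qs \<Longrightarrow> (x, t) \<in> group_acc M B \<Longrightarrow> Q t \<Longrightarrow>
       \<exists>t'\<in>W. (x, t') \<in> group_acc M B \<and> Q t'"
    by blast
  obtain e :: "nat \<Rightarrow> 'w" where e: "inj e"
    using infinite_countable_subset[OF infinite_UNIV] by blast
  define f where "f = e \<circ> to_nat_on W"
  have f: "inj_on f W"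
    unfolding f_def using cW e by (intro comp_inj_on inj_on_to_nat_on) (auto intro: inj_on_subset)
  define N :: "('a, 'p, 'w) model" where
    "N = \<lparr>worlds = f ` W, acc = (\<lambda>i. {(f x, f y) |x y. x \<in> W \<and> y \<in> W \<and> (x, y) \<in> acc M i}),
          val = (\<lambda>y. val M (inv_into W f y))\<rparr>"
  have accN: "(f x, z) \<in> acc N i \<longleftrightarrow> (\<exists>y\<in>W. z = f y \<and> (x, y) \<in> acc M i)" if "x \<in> W" for x z i
    using that f by (auto simp: N_def inj_on_def)
  have gaccN: "(f x, z) \<in> group_acc N B \<longleftrightarrow> (\<exists>y\<in>W. z = f y \<and> (x, y) \<in> group_acc M B)"
    if "x \<in> W" "B \<noteq> {}" for x z B
  proof
    assume L: "(f x, z) \<in> group_acc N B"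
    from that obtain i where "i \<in> B" by blast
    with L that obtain y where y: "y \<in> W" "z = f y" using accN by (auto simp: group_acc_def)
    have "(x, y) \<in> acc M j" if "j \<in> B" for j
    proof -
      from L that have "(f x, z) \<in> acc N j" by (auto simp: group_acc_def)
      with accN[OF \<open>x \<in> W\<close>] obtain y' where "y' \<in> W" "z = f y'" "(x, y') \<in> acc M j" by blast
      with y f show ?thesis by (auto simp: inj_on_def)
    qed
    with y show "\<exists>y\<in>W. z = f y \<and> (x, y) \<in> group_acc M B" by (auto simp: group_acc_def)
  next
    assume "\<exists>y\<in>W. z = f y \<and> (x, y) \<in> group_acc M B"
    then show "(f x, z) \<in> group_acc N B" using accN[OF that(1)] by (auto simp: group_acc_def)
  qed
  have box: "(\<forall>t. (x, t) \<in> group_acc M B \<longrightarrow> sat M t \<chi>) \<longleftrightarrow>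
      (\<forall>t\<in>W. (x, t) \<in> group_acc M B \<longrightarrow> sat M t \<chi>)"
    if "x \<in> W" "B \<noteq> {}" "\<chi> \<in> subfms \<phi>" for x B \<chi>
    using wit[OF that(1,2), of "\<lambda>t. \<not> sat M t \<chi>"] that(3) unfolding Qs_def by blast
  have single: "acc M i = group_acc M {i}" for i by (simp add: group_acc_def)
  have truth: "sat N (f x) \<chi> \<longleftrightarrow> sat M x \<chi>" if "x \<in> W" "subfms \<chi> \<subseteq> subfms \<phi>" for x \<chi>
    using that
  proof (induction \<chi> arbitrary: x)
    case (Atom p)
    then show ?case using f by (simp add: N_def)
  next
    case (Know i \<chi>)
    have IH: "sat N (f t) \<chi> \<longleftrightarrow> sat M t \<chi>" if "t \<in> W" for t
      using Know that by simp
    have "\<chi> \<in> subfms \<phi>" using Know.prems subfms_refl[of \<chi>] by auto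
    then show ?case
      using accN[OF \<open>x \<in> W\<close>] IH box[OF \<open>x \<in> W\<close>, of "{i}" \<chi>] by (auto simp: single)
  next
    case (Dist B \<chi>)
    have IH: "sat N (f t) \<chi> \<longleftrightarrow> sat M t \<chi>" if "t \<in> W" for t
      using Dist that by simp
    have "\<chi> \<in> subfms \<phi>" using Dist.prems subfms_refl[of \<chi>] by auto
    moreover have "set_of_neset B \<noteq> {}" using set_of_neset[of B] by simp
    ultimately show ?case
      using gaccN[OF \<open>x \<in> W\<close>] IH box[OF \<open>x \<in> W\<close>, of "set_of_neset B" \<chi>] by auto
  qed simp_all
  show thesis
  proof (rule that[of N "f s"])
    show K: "N \<in> KnD" using sW by (auto simp: N_def KnD_def)
    show "f s \<in> worlds N" using sW by (simp add: N_def)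
    show "sat N (f s) \<phi>" using truth[OF sW] sat by simp
    have wN: "worlds N = f ` W" by (simp add: N_def)
    show "M \<in> TnD \<longrightarrow> N \<in> TnD"
    proof
      assume "M \<in> TnD"
      have "(f x, f x) \<in> acc N i" if "x \<in> W" for x i
        using accN[OF that] that W \<open>M \<in> TnD\<close> unfolding TnD_def by blast
      with K wN show "N \<in> TnD" by (auto simp: TnD_def)
    qed
    show "M \<in> DnD \<longrightarrow> N \<in> DnD"
    proof
      assume "M \<in> DnD"
      have "\<exists>t\<in>worlds N. (y, t) \<in> acc N i" if "y \<in> worlds N" for y i
      proof -
        from that wN obtain x where x: "x \<in> W" "y = f x" by auto
        with W \<open>M \<in> DnD\<close> obtain t where "(x, t) \<in> group_acc M {i}"
          using single unfolding DnD_def by fast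
        then obtain t' where "t' \<in> W" "(x, t') \<in> group_acc M {i}"
          using wit[OF x(1), of "{i}" "\<lambda>_. True" t] by (auto simp: Qs_def)
        then show ?thesis using accN[OF x(1)] x wN by (auto simp: single)
      qed
      with K show "N \<in> DnD" by (simp add: DnD_def)
    qed
  qed
qed

theorem satisfiable_world_type:
  fixes \<phi> :: "('a::finite, 'p) fm"
  shows "satisfiable (KnD :: ('a, 'p, 'v) model set) \<phi> \<Longrightarrow>
         satisfiable (KnD :: ('a, 'p, 'w::infinite) model set) \<phi>"
    and "satisfiable (DnD :: ('a, 'p, 'v) model set) \<phi> \<Longrightarrow>
         satisfiable (DnD :: ('a, 'p, 'w::infinite) model set) \<phi>"
    and "satisfiable (TnD :: ('a, 'p, 'v) model set) \<phi> \<Longrightarrow>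
         satisfiable (TnD :: ('a, 'p, 'w::infinite) model set) \<phi>"
proof -
  assume "satisfiable (KnD :: ('a, 'p, 'v) model set) \<phi>"
  then obtain M :: "('a, 'p, 'v) model" and s where M: "M \<in> KnD" "s \<in> worlds M" "sat M s \<phi>"
    by (auto simp: satisfiable_def)
  obtain N :: "('a, 'p, 'w) model" and t where "N \<in> KnD" "t \<in> worlds N" "sat N t \<phi>"
    by (rule model_transfer[OF M])
  then show "satisfiable (KnD :: ('a, 'p, 'w) model set) \<phi>" by (auto simp: satisfiable_def)
next
  assume "satisfiable (DnD :: ('a, 'p, 'v) model set) \<phi>"
  then obtain M :: "('a, 'p, 'v) model" and s where
    D: "M \<in> DnD" and M: "M \<in> KnD" "s \<in> worlds M" "sat M s \<phi>"
    by (auto simp: satisfiable_def DnD_def)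
  obtain N :: "('a, 'p, 'w) model" and t where
    "N \<in> KnD" "t \<in> worlds N" "sat N t \<phi>" "M \<in> DnD \<longrightarrow> N \<in> DnD" "M \<in> TnD \<longrightarrow> N \<in> TnD"
    by (rule model_transfer[OF M])
  with D show "satisfiable (DnD :: ('a, 'p, 'w) model set) \<phi>" by (auto simp: satisfiable_def)
next
  assume "satisfiable (TnD :: ('a, 'p, 'v) model set) \<phi>"
  then obtain M :: "('a, 'p, 'v) model" and s where
    T: "M \<in> TnD" and M: "M \<in> KnD" "s \<in> worlds M" "sat M s \<phi>"
    by (auto simp: satisfiable_def TnD_def)
  obtain N :: "('a, 'p, 'w) model" and t where
    "N \<in> KnD" "t \<in> worlds N" "sat N t \<phi>" "M \<in> DnD \<longrightarrow> N \<in> DnD" "M \<in> TnD \<longrightarrow> N \<in> TnD"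
    by (rule model_transfer[OF M])
  with T show "satisfiable (TnD :: ('a, 'p, 'w) model set) \<phi>" by (auto simp: satisfiable_def)
qed

lemma entails_iff_not_satisfiable: "entails L \<phi> \<chi> \<longleftrightarrow> \<not> satisfiable L (Conj \<phi> (Neg \<chi>))"
  by (auto simp: entails_def satisfiable_def)

end

theory Submission
  imports Defs
begin

text \<open>
  For \<open>\<phi>\<close> of rank \<open>m\<close>, the interpolant \<open>\<psi>\<close> describes the type up to \<open>m\<close>-bisimilarity over
  \<open>P - {p}\<close> of a pointed model of \<open>\<phi>\<close>. Given a model \<open>N, t\<close> of \<open>\<psi>\<close>, there is thus a model
  \<open>M, s\<close> of \<open>\<phi>\<close> that is \<open>m\<close>-bisimilar to it over \<open>P - {p}\<close>. The product of \<open>M\<close> and \<open>N\<close>, restricted to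
  triples \<open>(k, x, y)\<close> with \<open>x\<close> and \<open>y\<close> \<open>k\<close>-bisimilar, satisfies \<open>\<phi>\<close> at \<open>(m, s, t)\<close> and agrees
  there with \<open>N, t\<close> on all formulas without \<open>p\<close>. As the relations are those of a
  product, they commute with the intersections that interpret distributed knowledge, and they
  inherit seriality and reflexivity.
\<close>

section \<open>Rank of formulas and bounded bisimulation\<close>

primrec rank :: "('a, 'p) fm \<Rightarrow> nat" where
  "rank (Atom p) = 1"
| "rank Top = 0"
| "rank (Neg \<phi>) = rank \<phi>"
| "rank (Conj \<phi> \<psi>) = max (rank \<phi>) (rank \<psi>)"
| "rank (Disj \<phi> \<psi>) = max (rank \<phi>) (rank \<psi>)"
| "rank (Know i \<phi>) = Suc (rank \<phi>)"
| "rank (Dist B \<phi>) = Suc (rank \<phi>)"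

text \<open>Atoms count as one step, both here and in \<open>rank\<close>, so that level \<open>0\<close> is the total relation.\<close>

primrec bisim ::
  "'p set \<Rightarrow> ('a, 'p, 'w) model \<Rightarrow> ('a, 'p, 'v) model \<Rightarrow> nat \<Rightarrow> 'w \<Rightarrow> 'v \<Rightarrow> bool" where
  "bisim Q M N 0 x y \<longleftrightarrow> True"
| "bisim Q M N (Suc m) x y \<longleftrightarrow>
    (\<forall>q\<in>Q. q \<in> val M x \<longleftrightarrow> q \<in> val N y) \<and>
    (\<forall>B x'. B \<noteq> {} \<longrightarrow> (x, x') \<in> group_acc M B \<longrightarrow>
      (\<exists>y'. (y, y') \<in> group_acc N B \<and> bisim Q M N m x' y')) \<and>
    (\<forall>B y'. B \<noteq> {} \<longrightarrow> (y, y') \<in> group_acc N B \<longrightarrow>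
      (\<exists>x'. (x, x') \<in> group_acc M B \<and> bisim Q M N m x' y'))"

lemma bisim_SucD:
  assumes "bisim Q M N (Suc m) x y"
  shows "q \<in> Q \<Longrightarrow> q \<in> val M x \<longleftrightarrow> q \<in> val N y"
    and "B \<noteq> {} \<Longrightarrow> (x, x') \<in> group_acc M B \<Longrightarrow>
      \<exists>y'. (y, y') \<in> group_acc N B \<and> bisim Q M N m x' y'"
    and "B \<noteq> {} \<Longrightarrow> (y, y') \<in> group_acc N B \<Longrightarrow>
      \<exists>x'. (x, x') \<in> group_acc M B \<and> bisim Q M N m x' y'"
  using assms by simp_all

lemma group_acc_singleton: "group_acc M {i} = acc M i"
  by (simp add: group_acc_def)

lemma set_of_neset_nonempty: "set_of_neset B \<noteq> {}"
  using set_of_neset[of B] by simp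

text \<open>Finiteness of the set of agents enters here: there are only finitely many groups, so the
  separating sets below stay finite.\<close>

lemma finite_neset: "finite (UNIV :: 'a::finite neset set)"
proof (rule finite_imageD)
  show "inj_on set_of_neset (UNIV :: 'a neset set)"
    by (simp add: inj_on_def set_of_neset_inject)
qed simp

lemma group_acc_worlds:
  assumes "M \<in> KnD" "B \<noteq> {}" "(x, x') \<in> group_acc M B"
  shows "x \<in> worlds M" "x' \<in> worlds M"
  using assms unfolding KnD_def group_acc_def by blast+

section \<open>State descriptions and separating sets of formulas\<close>

lemma ex_finite_conj:
  assumes "finite F"
  shows "\<exists>\<theta>. atoms \<theta> \<subseteq> (\<Union>\<phi>\<in>F. atoms \<phi>) \<and>
    (\<forall>(M :: ('a, 'p, 'w) model) s. sat M s \<theta> \<longleftrightarrow> (\<forall>\<phi>\<in>F. sat M s \<phi>))"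
  using assms
proof (induction F)
  case empty
  show ?case by (intro exI[of _ Top]) simp
next
  case (insert \<phi> F)
  then obtain \<theta> where "atoms \<theta> \<subseteq> (\<Union>\<phi>\<in>F. atoms \<phi>)"
    "\<forall>(M :: ('a, 'p, 'w) model) s. sat M s \<theta> \<longleftrightarrow> (\<forall>\<phi>\<in>F. sat M s \<phi>)"
    by blast
  then show ?case by (intro exI[of _ "Conj \<phi> \<theta>"]) auto
qed

lemma ex_finite_disj:
  assumes "finite F"
  shows "\<exists>\<theta>. atoms \<theta> \<subseteq> (\<Union>\<phi>\<in>F. atoms \<phi>) \<and>
    (\<forall>(M :: ('a, 'p, 'w) model) s. sat M s \<theta> \<longleftrightarrow> (\<exists>\<phi>\<in>F. sat M s \<phi>))"
proof -
  have "finite (Neg ` F)" using assms by simp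
  from ex_finite_conj[OF this, where 'w = 'w] obtain \<theta> where
    "atoms \<theta> \<subseteq> (\<Union>\<phi>\<in>Neg ` F. atoms \<phi>)"
    "\<forall>(M :: ('a, 'p, 'w) model) s. sat M s \<theta> \<longleftrightarrow> (\<forall>\<phi>\<in>Neg ` F. sat M s \<phi>)"
    by (elim exE conjE) (rule that)
  then show ?thesis by (intro exI[of _ "Neg \<theta>"]) auto
qed

lemma ex_state_description:
  assumes "finite F"
  shows "\<exists>\<theta>. atoms \<theta> \<subseteq> (\<Union>\<phi>\<in>F. atoms \<phi>) \<and>
    (\<forall>(M :: ('a, 'p, 'w) model) s. sat M s \<theta> \<longleftrightarrow> (\<forall>\<phi>\<in>F. sat M s \<phi> \<longleftrightarrow> \<phi> \<in> S))"
proof -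
  let ?l = "\<lambda>\<phi>. if \<phi> \<in> S then \<phi> else Neg \<phi>"
  have "finite (?l ` F)" using assms by simp
  from ex_finite_conj[OF this, where 'w = 'w] obtain \<theta> where
    \<theta>: "atoms \<theta> \<subseteq> (\<Union>\<phi>\<in>?l ` F. atoms \<phi>)"
    "\<forall>(M :: ('a, 'p, 'w) model) s. sat M s \<theta> \<longleftrightarrow> (\<forall>\<phi>\<in>?l ` F. sat M s \<phi>)"
    by (elim exE conjE) (rule that)
  have "(\<Union>\<phi>\<in>?l ` F. atoms \<phi>) \<subseteq> (\<Union>\<phi>\<in>F. atoms \<phi>)" by auto
  with \<theta>(1) have "atoms \<theta> \<subseteq> (\<Union>\<phi>\<in>F. atoms \<phi>)" by (rule subset_trans)
  moreover have "\<forall>(M :: ('a, 'p, 'w) model) s. sat M s \<theta> \<longleftrightarrow> (\<forall>\<phi>\<in>F. sat M s \<phi> \<longleftrightarrow> \<phi> \<in> S)"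
  proof (intro allI)
    fix M :: "('a, 'p, 'w) model" and s
    have "sat M s (?l \<phi>) \<longleftrightarrow> (sat M s \<phi> \<longleftrightarrow> \<phi> \<in> S)" for \<phi> by simp
    then show "sat M s \<theta> \<longleftrightarrow> (\<forall>\<phi>\<in>F. sat M s \<phi> \<longleftrightarrow> \<phi> \<in> S)"
      by (simp only: \<theta>(2) ball_simps)
  qed
  ultimately show ?thesis by (intro exI conjI)
qed

text \<open>Choice makes the description a function of \<open>S\<close>, so that families of subsets
  of \<open>F\<close> yield sets of formulas as images.\<close>

lemma state_descriptions:
  assumes "finite F"
  obtains D where "\<And>S. atoms (D S) \<subseteq> (\<Union>\<phi>\<in>F. atoms \<phi>)"
    and "\<And>S (M :: ('a, 'p, 'w) model) s. sat M s (D S) \<longleftrightarrow> (\<forall>\<phi>\<in>F. sat M s \<phi> \<longleftrightarrow> \<phi> \<in> S)"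
proof -
  have "\<forall>S. \<exists>\<theta>. atoms \<theta> \<subseteq> (\<Union>\<phi>\<in>F. atoms \<phi>) \<and>
      (\<forall>(M :: ('a, 'p, 'w) model) s. sat M s \<theta> \<longleftrightarrow> (\<forall>\<phi>\<in>F. sat M s \<phi> \<longleftrightarrow> \<phi> \<in> S))"
    by (intro allI ex_state_description assms)
  from choice[OF this] obtain D where D: "\<forall>S. atoms (D S) \<subseteq> (\<Union>\<phi>\<in>F. atoms \<phi>) \<and>
      (\<forall>(M :: ('a, 'p, 'w) model) s. sat M s (D S) \<longleftrightarrow> (\<forall>\<phi>\<in>F. sat M s \<phi> \<longleftrightarrow> \<phi> \<in> S))" ..
  show thesis
    by (rule that; rule D[THEN spec, THEN conjunct1]
        D[THEN spec, THEN conjunct2, THEN spec, THEN spec])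
qed

text \<open>By induction on \<open>m\<close>: if \<open>F\<close> separates at level
  \<open>m\<close>, then the atoms in \<open>Q\<close>, together with formulas telling which truth
  patterns on \<open>F\<close> occur among the successors for each group, separate at level
  \<open>Suc m\<close>.\<close>

lemma ex_separating_set:
  assumes "finite Q"
  shows "\<exists>F. finite F \<and> (\<forall>\<theta>\<in>F. atoms \<theta> \<subseteq> Q) \<and>
    (\<forall>(M :: ('a::finite, 'p, 'w) model) (N :: ('a, 'p, 'w) model) x y.
      (\<forall>\<theta>\<in>F. sat M x \<theta> \<longleftrightarrow> sat N y \<theta>) \<longrightarrow> bisim Q M N m x y)"
proof (induction m)
  case 0
  show ?case by (intro exI[of _ "{}"]) simp
next
  case (Suc m)
  then obtain F where F: "finite F" "\<forall>\<theta>\<in>F. atoms \<theta> \<subseteq> Q"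
    and sep: "\<forall>(M :: ('a, 'p, 'w) model) (N :: ('a, 'p, 'w) model) x y.
      (\<forall>\<theta>\<in>F. sat M x \<theta> \<longleftrightarrow> sat N y \<theta>) \<longrightarrow> bisim Q M N m x y"
    by (elim exE conjE) (rule that)
  note sep = sep[THEN spec, THEN spec, THEN spec, THEN spec, THEN mp]
  obtain D where D_atoms: "\<And>S. atoms (D S) \<subseteq> (\<Union>\<phi>\<in>F. atoms \<phi>)"
    and D: "\<And>S (M :: ('a, 'p, 'w) model) s. sat M s (D S) \<longleftrightarrow> (\<forall>\<phi>\<in>F. sat M s \<phi> \<longleftrightarrow> \<phi> \<in> S)"
    by (rule state_descriptions[OF F(1), where 'w = 'w]) (rule that)
  \<comment> \<open>\<open>Dist B (Neg (D S))\<close> fails exactly where some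
    \<open>B\<close>-successor satisfies, among the members of \<open>F\<close>, just those in
    \<open>S\<close>. Confining \<open>S\<close> to \<open>Pow F\<close> keeps \<open>G\<close>
    finite.\<close>
  define G where "G = Atom ` Q \<union> (\<lambda>(B, S). Dist B (Neg (D S))) ` (UNIV \<times> Pow F)"
  have transfer: "\<exists>y'. (y, y') \<in> group_acc N B \<and> (\<forall>\<theta>\<in>F. sat M x' \<theta> \<longleftrightarrow> sat N y' \<theta>)"
    if agree: "\<And>\<theta>. \<theta> \<in> G \<Longrightarrow> sat M x \<theta> \<longleftrightarrow> sat N y \<theta>"
      and B: "B \<noteq> {}" and x': "(x, x') \<in> group_acc M B"
    for M N :: "('a, 'p, 'w) model" and x y x' B
  proof -
    define S where "S = {\<theta> \<in> F. sat M x' \<theta>}"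
    let ?\<theta> = "Dist (Abs_neset B) (Neg (D S))"
    have B': "set_of_neset (Abs_neset B) = B" using B by (simp add: Abs_neset_inverse)
    have "?\<theta> \<in> G" unfolding G_def S_def by auto
    moreover have "\<not> sat M x ?\<theta>" using x' B' D[of M x' S] by (auto simp: S_def)
    ultimately have "\<not> sat N y ?\<theta>" using agree by blast
    then obtain y' where "(y, y') \<in> group_acc N B" "sat N y' (D S)" using B' by auto
    then show ?thesis using D[of N y' S] by (auto simp: S_def)
  qed
  have "finite G" unfolding G_def using assms F(1) finite_neset
    by (intro finite_UnI finite_imageI finite_cartesian_product) simp_all
  moreover have "\<forall>\<theta>\<in>G. atoms \<theta> \<subseteq> Q" using D_atoms F(2) unfolding G_def by fastforce
  moreover have "bisim Q M N (Suc m) x y"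
    if agree: "\<forall>\<theta>\<in>G. sat M x \<theta> \<longleftrightarrow> sat N y \<theta>" for M N :: "('a, 'p, 'w) model" and x y
  proof -
    have "\<forall>q\<in>Q. q \<in> val M x \<longleftrightarrow> q \<in> val N y"
    proof
      fix q
      assume "q \<in> Q"
      then have "Atom q \<in> G" by (simp add: G_def)
      with agree have "sat M x (Atom q) \<longleftrightarrow> sat N y (Atom q)" by blast
      then show "q \<in> val M x \<longleftrightarrow> q \<in> val N y" by simp
    qed
    moreover have "\<exists>y'. (y, y') \<in> group_acc N B \<and> bisim Q M N m x' y'"
      if Bx: "B \<noteq> {}" "(x, x') \<in> group_acc M B" for B x'
    proof -
      obtain y' where "(y, y') \<in> group_acc N B" "\<forall>\<theta>\<in>F. sat M x' \<theta> \<longleftrightarrow> sat N y' \<theta>"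
        using transfer[OF agree[rule_format] Bx] by blast
      with sep[of M x' N y'] show ?thesis by blast
    qed
    \<comment> \<open>Agreement on \<open>G\<close> is symmetric, so the back clause is
      \<open>transfer\<close> with the two models exchanged.\<close>
    moreover have "\<exists>x'. (x, x') \<in> group_acc M B \<and> bisim Q M N m x' y'"
      if By: "B \<noteq> {}" "(y, y') \<in> group_acc N B" for B y'
    proof -
      obtain x' where "(x, x') \<in> group_acc M B" "\<forall>\<theta>\<in>F. sat N y' \<theta> \<longleftrightarrow> sat M x' \<theta>"
        using transfer[OF agree[rule_format, symmetric] By] by blast
      with sep[of M x' N y'] show ?thesis by blast
    qed
    ultimately show ?thesis by simp
  qed
  ultimately show ?case by (intro exI[of _ G] conjI allI impI)
qed

section \<open>The amalgam of two models\<close>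

text \<open>The first component is a budget of steps for which \<open>x\<close> and \<open>y\<close>
  are known to match; the same pair may occur with several budgets.\<close>

definition amalgam_worlds ::
  "'p set \<Rightarrow> ('a, 'p, 'w) model \<Rightarrow> ('a, 'p, 'v) model \<Rightarrow> (nat \<times> 'w \<times> 'v) set" where
  "amalgam_worlds Q M N =
    {(m, x, y). x \<in> worlds M \<and> y \<in> worlds N \<and> bisim Q M N m x y}"

text \<open>At level \<open>0\<close> the world \<open>x\<close> is a dummy: only the steps of \<open>N\<close> are followed.\<close>

definition amalgam ::
  "'p set \<Rightarrow> 'p \<Rightarrow> ('a, 'p, 'w) model \<Rightarrow> ('a, 'p, 'v) model \<Rightarrow> ('a, 'p, nat \<times> 'w \<times> 'v) model" where
  "amalgam Q p M N =
    \<lparr>worlds = amalgam_worlds Q M N,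
     acc = (\<lambda>i. {((m, x, y), (m', x', y')) |m x y m' x' y'.
       (m, x, y) \<in> amalgam_worlds Q M N \<and> (m', x', y') \<in> amalgam_worlds Q M N \<and>
       m \<le> Suc m' \<and> (y, y') \<in> acc N i \<and> (m = 0 \<or> (x, x') \<in> acc M i)}),
     val = (\<lambda>(m, x, y). {q. if q = p then q \<in> val M x else q \<in> val N y})\<rparr>"

lemma worlds_amalgam:
  "(m, x, y) \<in> worlds (amalgam Q p M N) \<longleftrightarrow>
    x \<in> worlds M \<and> y \<in> worlds N \<and> bisim Q M N m x y"
  by (simp add: amalgam_def amalgam_worlds_def)

lemma val_amalgam:
  "q \<in> val (amalgam Q p M N) (m, x, y) \<longleftrightarrow> (if q = p then q \<in> val M x else q \<in> val N y)"
  by (simp add: amalgam_def)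

lemma acc_amalgam:
  "((m, x, y), (m', x', y')) \<in> acc (amalgam Q p M N) i \<longleftrightarrow>
    (m, x, y) \<in> worlds (amalgam Q p M N) \<and> (m', x', y') \<in> worlds (amalgam Q p M N) \<and>
    m \<le> Suc m' \<and> (y, y') \<in> acc N i \<and> (m = 0 \<or> (x, x') \<in> acc M i)"
  by (simp add: amalgam_def)

text \<open>Agents occur in \<open>acc_amalgam\<close> only in the conditions on the two
  coordinates, and the exception \<open>m = 0\<close> is the same for all of them, so the
  intersection passes to the coordinates. For empty \<open>B\<close> the left side would be the
  total relation.\<close>

lemma group_acc_amalgam:
  assumes "B \<noteq> {}"
  shows "((m, x, y), (m', x', y')) \<in> group_acc (amalgam Q p M N) B \<longleftrightarrow>
    (m, x, y) \<in> worlds (amalgam Q p M N) \<and> (m', x', y') \<in> worlds (amalgam Q p M N) \<and>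
    m \<le> Suc m' \<and> (y, y') \<in> group_acc N B \<and> (m = 0 \<or> (x, x') \<in> group_acc M B)"
  using assms unfolding group_acc_def INT_iff acc_amalgam by blast

text \<open>At a positive level the back clause of \<open>bisim\<close> supplies a step of
  \<open>M\<close> and the level drops by one; at level \<open>0\<close> no step of \<open>M\<close>
  is demanded. Hence steps of \<open>N\<close> are never blocked.\<close>

lemma group_acc_amalgam_right:
  assumes N: "N \<in> KnD" and M: "M \<in> KnD" and B: "B \<noteq> {}"
    and w: "(m, x, y) \<in> worlds (amalgam Q p M N)" and y': "(y, y') \<in> group_acc N B"
  shows "\<exists>m' x'. ((m, x, y), (m', x', y')) \<in> group_acc (amalgam Q p M N) B"
proof (cases m)
  case 0
  then have "((m, x, y), (0, x, y')) \<in> group_acc (amalgam Q p M N) B"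
    using w y' group_acc_worlds[OF N B y']
    unfolding group_acc_amalgam[OF B] by (simp add: worlds_amalgam del: bisim.simps(2))
  then show ?thesis by blast
next
  case (Suc k)
  then obtain x' where x': "(x, x') \<in> group_acc M B" "bisim Q M N k x' y'"
    using bisim_SucD(3)[of Q M N k x y B y'] w B y' unfolding worlds_amalgam Suc by blast
  then have "((m, x, y), (k, x', y')) \<in> group_acc (amalgam Q p M N) B"
    using w y' Suc group_acc_worlds[OF N B y'] group_acc_worlds[OF M B x'(1)]
    unfolding group_acc_amalgam[OF B] by (simp add: worlds_amalgam del: bisim.simps(2))
  then show ?thesis by blast
qed

text \<open>The forth clause of \<open>bisim\<close> pays one level for a step of \<open>M\<close>
  and yields a single \<open>y'\<close> for all agents in \<open>B\<close> at once.\<close>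

lemma group_acc_amalgam_left:
  assumes N: "N \<in> KnD" and M: "M \<in> KnD" and B: "B \<noteq> {}"
    and w: "(Suc m, x, y) \<in> worlds (amalgam Q p M N)" and x': "(x, x') \<in> group_acc M B"
  shows "\<exists>y'. ((Suc m, x, y), (m, x', y')) \<in> group_acc (amalgam Q p M N) B"
proof -
  obtain y' where y': "(y, y') \<in> group_acc N B" "bisim Q M N m x' y'"
    using bisim_SucD(2)[of Q M N m x y B x'] w B x' unfolding worlds_amalgam by blast
  then have "((Suc m, x, y), (m, x', y')) \<in> group_acc (amalgam Q p M N) B"
    using w x' group_acc_worlds[OF M B x'] group_acc_worlds[OF N B y'(1)]
    unfolding group_acc_amalgam[OF B] by (simp add: worlds_amalgam del: bisim.simps(2))
  then show ?thesis by blast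
qed

lemma amalgam_KnD:
  assumes "M \<in> KnD" "N \<in> KnD"
  shows "amalgam Q p M N \<in> KnD"
proof -
  obtain x y where "x \<in> worlds M" "y \<in> worlds N" using assms by (auto simp: KnD_def)
  \<comment> \<open>At level \<open>0\<close> bisimilarity is trivial, so any two worlds may be
    paired.\<close>
  then have "(0, x, y) \<in> worlds (amalgam Q p M N)" by (simp add: worlds_amalgam)
  then show ?thesis by (auto simp: KnD_def acc_amalgam)
qed

lemma amalgam_DnD:
  assumes M: "M \<in> DnD" and N: "N \<in> DnD"
  shows "amalgam Q p M N \<in> DnD"
proof -
  have K: "M \<in> KnD" "N \<in> KnD" using M N by (simp_all add: DnD_def)
  have "\<exists>v\<in>worlds (amalgam Q p M N). ((m, x, y), v) \<in> acc (amalgam Q p M N) i"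
    if w: "(m, x, y) \<in> worlds (amalgam Q p M N)" for m x y i
  proof -
    from w N obtain y' where "(y, y') \<in> group_acc N {i}"
      unfolding worlds_amalgam DnD_def group_acc_singleton by blast
    with group_acc_amalgam_right[OF K(2,1) _ w] obtain m' x' where
      "((m, x, y), (m', x', y')) \<in> group_acc (amalgam Q p M N) {i}" by blast
    then show ?thesis unfolding group_acc_singleton by (meson acc_amalgam)
  qed
  then show ?thesis using amalgam_KnD[OF K] by (auto simp: DnD_def)
qed

text \<open>A loop keeps its level, which is why steps of the amalgam obey
  \<open>m \<le> Suc m'\<close> instead of \<open>m = Suc m'\<close>.\<close>

lemma amalgam_TnD:
  assumes "M \<in> TnD" "N \<in> TnD"
  shows "amalgam Q p M N \<in> TnD"
proof -
  have "M \<in> KnD" "N \<in> KnD" using assms by (simp_all add: TnD_def)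
  with assms show ?thesis using amalgam_KnD[of M N Q p]
    by (auto simp: TnD_def acc_amalgam worlds_amalgam)
qed

section \<open>Truth in the amalgam\<close>

text \<open>With individual knowledge seen as that of a singleton group, one box lemma for each side
  covers both modalities.\<close>

lemma sat_Know_iff_group_acc:
  "sat M s (Know i \<phi>) \<longleftrightarrow> (\<forall>t. (s, t) \<in> group_acc M {i} \<longrightarrow> sat M t \<phi>)"
  by (simp add: group_acc_singleton)

text \<open>Projection to \<open>N\<close> is a bounded morphism for every group relation:
  \<open>group_acc_amalgam\<close> projects steps and \<open>group_acc_amalgam_right\<close> lifts
  them. \<open>IH\<close> ranges over all levels because a step may change the level.\<close>

lemma box_amalgam_right:
  assumes M: "M \<in> KnD" and N: "N \<in> KnD" and B: "B \<noteq> {}"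
    and w: "(m, x, y) \<in> worlds (amalgam Q p M N)"
    and IH: "\<And>m x y. (m, x, y) \<in> worlds (amalgam Q p M N) \<Longrightarrow>
      sat (amalgam Q p M N) (m, x, y) \<chi> \<longleftrightarrow> sat N y \<chi>"
  shows "(\<forall>v. ((m, x, y), v) \<in> group_acc (amalgam Q p M N) B \<longrightarrow> sat (amalgam Q p M N) v \<chi>) \<longleftrightarrow>
    (\<forall>y'. (y, y') \<in> group_acc N B \<longrightarrow> sat N y' \<chi>)" (is "?l \<longleftrightarrow> ?r")
proof
  assume l: ?l
  show ?r
  proof (intro allI impI)
    fix y'
    assume "(y, y') \<in> group_acc N B"
    then obtain m' x' where v: "((m, x, y), (m', x', y')) \<in> group_acc (amalgam Q p M N) B"
      using group_acc_amalgam_right[OF N M B w] by blast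
    with l have "sat (amalgam Q p M N) (m', x', y') \<chi>" by blast
    with v IH show "sat N y' \<chi>" by (simp add: group_acc_amalgam[OF B])
  qed
next
  assume r: ?r
  show ?l
  proof (intro allI impI)
    fix v
    assume v: "((m, x, y), v) \<in> group_acc (amalgam Q p M N) B"
    obtain m' x' y' where v_eq: "v = (m', x', y')" by (cases v)
    from v r IH show "sat (amalgam Q p M N) v \<chi>"
      unfolding v_eq by (simp add: group_acc_amalgam[OF B])
  qed
qed

text \<open>The amalgam takes every atom other than \<open>p\<close> from \<open>N\<close>, even
  those outside \<open>Q\<close>; hence \<chi> may contain atoms foreign to the interpolant and may
  have any rank.\<close>

lemma sat_amalgam_right:
  assumes M: "M \<in> KnD" and N: "N \<in> KnD"
    and "(m, x, y) \<in> worlds (amalgam Q p M N)" "p \<notin> atoms \<chi>"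
  shows "sat (amalgam Q p M N) (m, x, y) \<chi> \<longleftrightarrow> sat N y \<chi>"
  using assms(3-)
proof (induction \<chi> arbitrary: m x y)
  case (Atom q)
  then show ?case by (auto simp: val_amalgam)
next
  case (Know i \<chi>)
  then show ?case
    unfolding sat_Know_iff_group_acc by (intro box_amalgam_right[OF M N]) simp_all
next
  case (Dist B \<chi>)
  then show ?case
    unfolding sat.simps by (intro box_amalgam_right[OF M N set_of_neset_nonempty]) simp_all
qed simp_all

text \<open>A step lowers the level by at most one, so every successor has level at least
  \<open>m\<close> and falls under \<open>IH\<close>; conversely, each \<open>B\<close>-successor of
  \<open>x\<close> is reached at level exactly \<open>m\<close>.\<close>

lemma box_amalgam_left:
  assumes M: "M \<in> KnD" and N: "N \<in> KnD" and B: "B \<noteq> {}"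
    and w: "(Suc m, x, y) \<in> worlds (amalgam Q p M N)"
    and IH: "\<And>m' x y. (m', x, y) \<in> worlds (amalgam Q p M N) \<Longrightarrow> m \<le> m' \<Longrightarrow>
      sat (amalgam Q p M N) (m', x, y) \<phi> \<longleftrightarrow> sat M x \<phi>"
  shows "(\<forall>v. ((Suc m, x, y), v) \<in> group_acc (amalgam Q p M N) B \<longrightarrow>
      sat (amalgam Q p M N) v \<phi>) \<longleftrightarrow>
    (\<forall>x'. (x, x') \<in> group_acc M B \<longrightarrow> sat M x' \<phi>)" (is "?l \<longleftrightarrow> ?r")
proof
  assume l: ?l
  show ?r
  proof (intro allI impI)
    fix x'
    assume "(x, x') \<in> group_acc M B"
    then obtain y' where v: "((Suc m, x, y), (m, x', y')) \<in> group_acc (amalgam Q p M N) B"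
      using group_acc_amalgam_left[OF N M B w] by blast
    with l have "sat (amalgam Q p M N) (m, x', y') \<phi>" by blast
    with v IH show "sat M x' \<phi>" by (simp add: group_acc_amalgam[OF B])
  qed
next
  assume r: ?r
  show ?l
  proof (intro allI impI)
    fix v
    assume v: "((Suc m, x, y), v) \<in> group_acc (amalgam Q p M N) B"
    obtain m' x' y' where v_eq: "v = (m', x', y')" by (cases v)
    from v r IH show "sat (amalgam Q p M N) v \<phi>"
      unfolding v_eq by (simp add: group_acc_amalgam[OF B])
  qed
qed

lemma sat_amalgam_left:
  assumes M: "M \<in> KnD" and N: "N \<in> KnD"
    and "(m, x, y) \<in> worlds (amalgam Q p M N)" "atoms \<phi> \<subseteq> insert p Q" "rank \<phi> \<le> m"
  shows "sat (amalgam Q p M N) (m, x, y) \<phi> \<longleftrightarrow> sat M x \<phi>"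
  using assms(3-)
proof (induction \<phi> arbitrary: m x y)
  case (Atom q)
  \<comment> \<open>An atom has rank 1, so the level is positive and \<open>x\<close>,
    \<open>y\<close> agree on \<open>Q\<close>; the atom \<open>p\<close> is read off in
    \<open>M\<close>.\<close>
  then obtain k where "m = Suc k" by (cases m) auto
  with Atom.prems(1) have "bisim Q M N (Suc k) x y" by (simp only: worlds_amalgam)
  from bisim_SucD(1)[OF this] Atom.prems(2) show ?case by (auto simp: val_amalgam)
next
  case (Know i \<phi>)
  then obtain k where m: "m = Suc k" "rank \<phi> \<le> k" by (cases m) auto
  with Know show ?case
    unfolding sat_Know_iff_group_acc m(1) by (intro box_amalgam_left[OF M N]) simp_all
next
  case (Dist B \<phi>)
  then obtain k where m: "m = Suc k" "rank \<phi> \<le> k" by (cases m) auto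
  with Dist show ?case
    unfolding sat.simps m(1)
    by (intro box_amalgam_left[OF M N set_of_neset_nonempty]) simp_all
qed simp_all

text \<open>Level \<open>rank \<phi>\<close> is just enough for \<phi> to be read off in
  \<open>M\<close>, while \<chi> is read off in \<open>N\<close> at any level.\<close>

lemma sat_amalgam_Conj:
  assumes "M \<in> KnD" "N \<in> KnD" "s \<in> worlds M" "t \<in> worlds N"
    and "bisim (P - {p}) M N (rank \<phi>) s t" "atoms \<phi> \<subseteq> P" "p \<notin> atoms \<chi>"
    and "sat M s \<phi>" "sat N t \<chi>"
  shows "(rank \<phi>, s, t) \<in> worlds (amalgam (P - {p}) p M N)"
    "sat (amalgam (P - {p}) p M N) (rank \<phi>, s, t) (Conj \<phi> \<chi>)"
proof -
  show w: "(rank \<phi>, s, t) \<in> worlds (amalgam (P - {p}) p M N)"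
    using assms by (simp add: worlds_amalgam)
  have "atoms \<phi> \<subseteq> insert p (P - {p})" using assms(6) by blast
  then show "sat (amalgam (P - {p}) p M N) (rank \<phi>, s, t) (Conj \<phi> \<chi>)"
    using sat_amalgam_left[OF assms(1,2) w] sat_amalgam_right[OF assms(1,2) w] assms by simp
qed

section \<open>Construction of the interpolant\<close>

lemma satisfiableI: "M \<in> L \<Longrightarrow> s \<in> worlds M \<Longrightarrow> sat M s \<phi> \<Longrightarrow> satisfiable L \<phi>"
  unfolding satisfiable_def by blast

text \<open>Isolates what the construction asks of \<open>L\<close>: a model of \<phi> and a model
  of \<chi> that are bisimilar up to \<open>rank \<phi>\<close> away from \<open>p\<close> can be
  merged. The three systems differ only in how this is verified.\<close>

lemma uniform_interpolation_if_amalgamation: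
  fixes L :: "('a::finite, 'p, 'w) model set"
  assumes amalgamation: "\<And>M N s t P p \<phi> \<chi>. M \<in> L \<Longrightarrow> N \<in> L \<Longrightarrow> s \<in> worlds M \<Longrightarrow> t \<in> worlds N \<Longrightarrow>
    bisim (P - {p}) M N (rank \<phi>) s t \<Longrightarrow> atoms \<phi> \<subseteq> P \<Longrightarrow> p \<notin> atoms \<chi> \<Longrightarrow>
    sat M s \<phi> \<Longrightarrow> sat N t \<chi> \<Longrightarrow> satisfiable L (Conj \<phi> \<chi>)"
  shows "uniform_interpolation L"
  unfolding uniform_interpolation_def
proof (intro allI impI)
  fix P :: "'p set" and \<phi> :: "('a, 'p) fm" and p
  assume P: "finite P" "atoms \<phi> \<subseteq> P" and \<phi>: "satisfiable L \<phi>"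
  have "finite (P - {p})" using P(1) by simp
  from ex_separating_set[OF this, of "rank \<phi>"] obtain F where
    F: "finite F" "\<forall>\<theta>\<in>F. atoms \<theta> \<subseteq> P - {p}"
    and sep: "\<forall>(M :: ('a, 'p, 'w) model) (N :: ('a, 'p, 'w) model) x y.
      (\<forall>\<theta>\<in>F. sat M x \<theta> \<longleftrightarrow> sat N y \<theta>) \<longrightarrow> bisim (P - {p}) M N (rank \<phi>) x y"
    by (elim exE conjE) (rule that)
  note sep = sep[THEN spec, THEN spec, THEN spec, THEN spec, THEN mp]
  obtain D where D_atoms: "\<And>S. atoms (D S) \<subseteq> (\<Union>\<phi>\<in>F. atoms \<phi>)"
    and D: "\<And>S (M :: ('a, 'p, 'w) model) s. sat M s (D S) \<longleftrightarrow> (\<forall>\<phi>\<in>F. sat M s \<phi> \<longleftrightarrow> \<phi> \<in> S)"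
    by (rule state_descriptions[OF F(1), where 'w = 'w]) (rule that)
  \<comment> \<open>The truth patterns on \<open>F\<close> that some pointed model in
    \<open>L\<close> realises together with \<phi>. As subsets of \<open>F\<close> they are finitely
    many, and \<psi> will be the disjunction of their descriptions.\<close>
  define \<S> where "\<S> = {S. S \<subseteq> F \<and> (\<exists>M\<in>L. \<exists>s\<in>worlds M. sat M s \<phi> \<and> sat M s (D S))}"
  have "finite (D ` \<S>)" unfolding \<S>_def using F(1) by simp
  from ex_finite_disj[OF this, where 'w = 'w] obtain \<psi> where
    \<psi>_atoms: "atoms \<psi> \<subseteq> (\<Union>\<theta>\<in>D ` \<S>. atoms \<theta>)"
    and \<psi>: "\<forall>(M :: ('a, 'p, 'w) model) s. sat M s \<psi> \<longleftrightarrow> (\<exists>\<theta>\<in>D ` \<S>. sat M s \<theta>)"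
    by (elim exE conjE) (rule that)
  have \<phi>\<psi>: "sat M s \<psi>" if "M \<in> L" "s \<in> worlds M" "sat M s \<phi>" for M s
  proof -
    have "sat M s (D {\<theta> \<in> F. sat M s \<theta>})" by (simp add: D)
    moreover from this have "{\<theta> \<in> F. sat M s \<theta>} \<in> \<S>" using that unfolding \<S>_def by blast
    ultimately show ?thesis using \<psi> by blast
  qed
  have "satisfiable L (Conj \<phi> \<chi>)"
    if N: "N \<in> L" "t \<in> worlds N" "sat N t \<psi>" and \<chi>: "p \<notin> atoms \<chi>" "sat N t \<chi>" for N t \<chi>
  proof -
    from N(3) \<psi> obtain S where "S \<in> \<S>" and t: "sat N t (D S)" by blast
    then obtain M s where M: "M \<in> L" "s \<in> worlds M" "sat M s \<phi>" and s: "sat M s (D S)"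
      unfolding \<S>_def by blast
    \<comment> \<open>Both worlds satisfy the same \<open>D S\<close>, hence agree on
      \<open>F\<close>, which separates.\<close>
    have "bisim (P - {p}) M N (rank \<phi>) s t" using s t unfolding D by (intro sep) simp
    then show ?thesis using amalgamation[OF M(1) N(1) M(2) N(2) _ P(2) \<chi>(1) M(3) \<chi>(2)] by blast
  qed
  then have \<psi>\<phi>: "satisfiable L (Conj \<phi> \<chi>)"
    if "satisfiable L (Conj \<psi> \<chi>)" "p \<notin> atoms \<chi>" for \<chi>
    using that by (auto simp: satisfiable_def)
  have "entails L \<phi> \<chi> \<longleftrightarrow> entails L \<psi> \<chi>" if "p \<notin> atoms \<chi>" for \<chi>
  proof
    assume "entails L \<phi> \<chi>"
    then show "entails L \<psi> \<chi>"
      \<comment> \<open>A counterexample to the entailment from \<psi> satisfies \<psi> and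
        \<open>Neg \<chi>\<close>, so \<phi> and \<open>Neg \<chi>\<close> would be jointly
        satisfiable.\<close>
      using \<psi>\<phi>[of "Neg \<chi>"] that by (auto simp: entails_iff_not_satisfiable)
  next
    assume "entails L \<psi> \<chi>"
    then show "entails L \<phi> \<chi>" using \<phi>\<psi> by (auto simp: entails_def)
  qed
  moreover have "atoms \<psi> \<subseteq> P - {p}" using \<psi>_atoms D_atoms F(2) by fast
  moreover have "satisfiable L \<psi>" using \<phi> \<phi>\<psi> by (auto simp: satisfiable_def)
  ultimately show "\<exists>\<psi>. atoms \<psi> \<subseteq> P - {p} \<and> satisfiable L \<psi> \<and>
      (\<forall>\<chi>. p \<notin> atoms \<chi> \<longrightarrow> (entails L \<phi> \<chi> \<longleftrightarrow> entails L \<psi> \<chi>))"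
    by blast
qed

section \<open>The three systems\<close>

lemma uniform_interpolation_KnD:
  "uniform_interpolation (KnD :: ('a::finite, 'p, 'w::infinite) model set)"
proof (rule uniform_interpolation_if_amalgamation)
  fix M N :: "('a, 'p, 'w) model" and s t P p and \<phi> \<chi> :: "('a, 'p) fm"
  assume MN: "M \<in> KnD" "N \<in> KnD" and st: "s \<in> worlds M" "t \<in> worlds N"
    "bisim (P - {p}) M N (rank \<phi>) s t" "atoms \<phi> \<subseteq> P" "p \<notin> atoms \<chi>" "sat M s \<phi>" "sat N t \<chi>"
  note sat = sat_amalgam_Conj[OF MN st]
  have "satisfiable (KnD :: ('a, 'p, nat \<times> 'w \<times> 'w) model set) (Conj \<phi> \<chi>)"
    using amalgam_KnD[OF MN] sat by (rule satisfiableI)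
  \<comment> \<open>The amalgam has worlds in \<open>nat \<times> 'w \<times> 'w\<close>; as
    \<open>'w\<close> is infinite, satisfiability carries back to it.\<close>
  then show "satisfiable (KnD :: ('a, 'p, 'w) model set) (Conj \<phi> \<chi>)"
    by (rule satisfiable_world_type(1))
qed

lemma uniform_interpolation_DnD:
  "uniform_interpolation (DnD :: ('a::finite, 'p, 'w::infinite) model set)"
proof (rule uniform_interpolation_if_amalgamation)
  fix M N :: "('a, 'p, 'w) model" and s t P p and \<phi> \<chi> :: "('a, 'p) fm"
  assume MN: "M \<in> DnD" "N \<in> DnD" and st: "s \<in> worlds M" "t \<in> worlds N"
    "bisim (P - {p}) M N (rank \<phi>) s t" "atoms \<phi> \<subseteq> P" "p \<notin> atoms \<chi>" "sat M s \<phi>" "sat N t \<chi>"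
  from MN have K: "M \<in> KnD" "N \<in> KnD" by (simp_all add: DnD_def)
  note sat = sat_amalgam_Conj[OF K st]
  have "satisfiable (DnD :: ('a, 'p, nat \<times> 'w \<times> 'w) model set) (Conj \<phi> \<chi>)"
    using amalgam_DnD[OF MN] sat by (rule satisfiableI)
  then show "satisfiable (DnD :: ('a, 'p, 'w) model set) (Conj \<phi> \<chi>)"
    by (rule satisfiable_world_type(2))
qed

lemma uniform_interpolation_TnD:
  "uniform_interpolation (TnD :: ('a::finite, 'p, 'w::infinite) model set)"
proof (rule uniform_interpolation_if_amalgamation)
  fix M N :: "('a, 'p, 'w) model" and s t P p and \<phi> \<chi> :: "('a, 'p) fm"
  assume MN: "M \<in> TnD" "N \<in> TnD" and st: "s \<in> worlds M" "t \<in> worlds N"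
    "bisim (P - {p}) M N (rank \<phi>) s t" "atoms \<phi> \<subseteq> P" "p \<notin> atoms \<chi>" "sat M s \<phi>" "sat N t \<chi>"
  from MN have K: "M \<in> KnD" "N \<in> KnD" by (simp_all add: TnD_def)
  note sat = sat_amalgam_Conj[OF K st]
  have "satisfiable (TnD :: ('a, 'p, nat \<times> 'w \<times> 'w) model set) (Conj \<phi> \<chi>)"
    using amalgam_TnD[OF MN] sat by (rule satisfiableI)
  then show "satisfiable (TnD :: ('a, 'p, 'w) model set) (Conj \<phi> \<chi>)"
    by (rule satisfiable_world_type(3))
qed

theorem theorem4p4:
  shows "uniform_interpolation (KnD :: ('a::finite, 'p::countable, 'w::infinite) model set) \<and>
         uniform_interpolation (DnD :: ('a::finite, 'p::countable, 'w::infinite) model set) \<and>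
         uniform_interpolation (TnD :: ('a::finite, 'p::countable, 'w::infinite) model set)"
  by (intro conjI uniform_interpolation_KnD uniform_interpolation_DnD uniform_interpolation_TnD)

end
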